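(* Let $n\ge 2$ and let $\{1,\dots,n\}=C\,\dot\cup\,D$ be a partition with $|C|=m\ge 1$ and $|D|=n-m\ge 1$. Let $S\in\mathbb{C}^{n\times n}$, $\xi\in\mathbb{R}$ with $\xi\neq 0$, $P=\mathrm{diag}(\mathbf 1_{i\in C})$, and let $\widehat K\in\mathbb{C}^{n\times n}$ be Hermitian positive definite. For $b>0$ set $\widehat A=S+ib\xi P$ and $\widehat G=\widehat A\,\widehat K\,\widehat A^{\mathsf H}$, and let $$L_\infty=S_{DD}\,\bigl(\widehat K/\widehat K_{CC}\bigr)\,S_{DD}^{\mathsf H}.$$ Then $$\widehat G_{DD}-L_\infty=X\,\widehat K_{CC}\,X^{\mathsf H}\succeq 0,\qquad X=S_{DC}+S_{DD}\,\widehat K_{DC}\,\widehat K_{CC}^{-1}.$$ In particular $L_\infty\preceq\widehat G_{DD}$. Moreover, two systems with the same block $S_{DD}$ and the same kernel $\widehat K$, but with arbitrarily different couplings $S_{DC}$, $S_{CD}$, have the same limit rate $\lambda_{\min}(L_\infty)$.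
   Context: $M^{\mathsf H}$ denotes the conjugate transpose; $\lambda_{\min}$ the smallest eigenvalue of a Hermitian matrix; $M_1\preceq M_2$ denotes the Loewner order, i.e. $M_2-M_1$ is positive semidefinite. For $M\in\mathbb{C}^{n\times n}$ and the partition $\{1,\dots,n\}=C\,\dot\cup\,D$, the blocks of $M$ are denoted $M_{CC}$, $M_{CD}$, $M_{DC}$, $M_{DD}$. When $M_{CC}$ is invertible, the Schur complement is $M/M_{CC}:=M_{DD}-M_{DC}M_{CC}^{-1}M_{CD}$. The block $\widehat G_{DD}$ does not depend on $b$, since the rows of $P$ indexed by $D$ vanish. The limit rate of a system is $\lambda_{\min}(L_\infty)$. *)

theory Defs
  imports
    "Jordan_Normal_Form.Spectral_Radius"
    "Jordan_Normal_Form.Schur_Decomposition"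
    "Jordan_Normal_Form.Gauss_Jordan_Elimination"
    "Jordan_Normal_Form.DL_Submatrix"
begin

text \<open>
  Rows and columns are numbered from 0, so a partition of the index set is given by sets C and D of
  natural numbers with union \<open>{0..<n}\<close>. The block of M with rows I and columns J is
  \<open>submatrix M I J\<close>, which lists the indices in increasing order.
\<close>

definition hermitian :: "complex mat \<Rightarrow> bool" where
  "hermitian M \<longleftrightarrow> square_mat M \<and> mat_adjoint M = M"

text \<open>
  The order on complex numbers is the componentwise one: \<open>0 \<le> z\<close> (resp. \<open>0 < z\<close>) says
  that z is real and nonnegative (resp. positive).
\<close>

definition pos_semidef :: "complex mat \<Rightarrow> bool" where
  "pos_semidef M \<longleftrightarrow> hermitian M \<and>
     (\<forall>v \<in> carrier_vec (dim_row M). 0 \<le> (M *\<^sub>v v) \<bullet>c v)"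

definition pos_def :: "complex mat \<Rightarrow> bool" where
  "pos_def M \<longleftrightarrow> hermitian M \<and>
     (\<forall>v \<in> carrier_vec (dim_row M). v \<noteq> 0\<^sub>v (dim_row M) \<longrightarrow> 0 < (M *\<^sub>v v) \<bullet>c v)"

definition loewner_le :: "complex mat \<Rightarrow> complex mat \<Rightarrow> bool" (infix "\<preceq>\<^sub>L" 50) where
  "M1 \<preceq>\<^sub>L M2 \<longleftrightarrow>
     dim_row M1 = dim_row M2 \<and> dim_col M1 = dim_col M2 \<and> pos_semidef (M2 - M1)"

text \<open>Meant for Hermitian matrices: their eigenvalues are real, and \<open>Re\<close> only changes the type.\<close>

definition lambda_min :: "complex mat \<Rightarrow> real" where
  "lambda_min M = Min (Re ` spectrum M)"

text \<open>Unspecified unless M is invertible.\<close>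

definition mat_inv :: "complex mat \<Rightarrow> complex mat" where
  "mat_inv M = the (mat_inverse M)"

text \<open>The Schur complement of the block of M indexed by C, where D is the complementary index set.\<close>

definition schur_complement :: "complex mat \<Rightarrow> nat set \<Rightarrow> nat set \<Rightarrow> complex mat" where
  "schur_complement M C D =
     submatrix M D D - submatrix M D C * mat_inv (submatrix M C C) * submatrix M C D"

definition P_mat :: "nat \<Rightarrow> nat set \<Rightarrow> complex mat" where
  "P_mat n C = mat_diag n (\<lambda>i. if i \<in> C then 1 else 0)"

definition A_hat :: "nat \<Rightarrow> nat set \<Rightarrow> complex mat \<Rightarrow> real \<Rightarrow> real \<Rightarrow> complex mat" where
  "A_hat n C S \<xi> b = S + (\<i> * complex_of_real b * complex_of_real \<xi>) \<cdot>\<^sub>m P_mat n C"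

definition G_hat ::
    "nat \<Rightarrow> nat set \<Rightarrow> complex mat \<Rightarrow> complex mat \<Rightarrow> real \<Rightarrow> real \<Rightarrow> complex mat" where
  "G_hat n C S K \<xi> b = A_hat n C S \<xi> b * K * mat_adjoint (A_hat n C S \<xi> b)"

definition L_inf :: "nat set \<Rightarrow> nat set \<Rightarrow> complex mat \<Rightarrow> complex mat \<Rightarrow> complex mat" where
  "L_inf C D S K =
     submatrix S D D * schur_complement K C D * mat_adjoint (submatrix S D D)"

definition limit_rate :: "nat set \<Rightarrow> nat set \<Rightarrow> complex mat \<Rightarrow> complex mat \<Rightarrow> real" where
  "limit_rate C D S K = lambda_min (L_inf C D S K)"

definition X_mat :: "nat set \<Rightarrow> nat set \<Rightarrow> complex mat \<Rightarrow> complex mat \<Rightarrow> complex mat" where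
  "X_mat C D S K =
     submatrix S D C + submatrix S D D * submatrix K D C * mat_inv (submatrix K C C)"

end

theory Submission
  imports Defs
begin

text \<open>
  Write \<open>a = S\<^bsub>DC\<^esub>\<close> and \<open>d = S\<^bsub>DD\<^esub>\<close>. The term \<open>i b \<xi> P\<close> lives in the rows indexed by C,
  so the rows of \<open>A = S + i b \<xi> P\<close> indexed by D are those of \<open>S\<close>, and the block \<open>G\<^bsub>DD\<^esub>\<close>
  of \<open>A K A\<^sup>H\<close> is the Gram matrix \<open>[a d] K [a d]\<^sup>H\<close>, whatever \<open>b\<close> is. Completing the square
  in the C-coordinates,
    \<open>[a d] K [a d]\<^sup>H = (a + d K\<^bsub>DC\<^esub> K\<^bsub>CC\<^esub>\<^sup>-\<^sup>1) K\<^bsub>CC\<^esub> (a + d K\<^bsub>DC\<^esub> K\<^bsub>CC\<^esub>\<^sup>-\<^sup>1)\<^sup>H + d (K/K\<^bsub>CC\<^esub>) d\<^sup>H\<close>,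
  is the asserted identity (\<open>block_Gram_minus_Schur\<close>).

  The remainder is a congruence transform of \<open>K\<^bsub>CC\<^esub>\<close>. A principal block of a positive definite
  matrix is positive definite (\<open>pos_def_principal_submatrix\<close>), which gives both the inverse of
  \<open>K\<^bsub>CC\<^esub>\<close> and, by \<open>pos_semidef_congruence\<close>, the sign of the remainder. The limit rate involves
  \<open>S\<close> only through \<open>d\<close>, so the couplings cannot change it.
\<close>

section \<open>The conjugate transpose\<close>

lemma dim_mat_adjoint [simp]:
  "dim_row (mat_adjoint A) = dim_col A" "dim_col (mat_adjoint A) = dim_row A"
  by (auto simp: mat_adjoint_def)

lemma mat_adjoint_carrier [simp]:
  "A \<in> carrier_mat p q \<Longrightarrow> mat_adjoint A \<in> carrier_mat q p"
  by (intro carrier_matI) auto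

lemma index_mat_adjoint [simp]:
  "i < dim_col A \<Longrightarrow> j < dim_row A \<Longrightarrow> mat_adjoint A $$ (i, j) = conjugate (A $$ (j, i))"
  by (simp add: mat_adjoint_def mat_of_rows_def)

lemma mat_adjoint_adjoint [simp]: "mat_adjoint (mat_adjoint A) = A"
  by (rule eq_matI) auto

lemma mat_adjoint_one [simp]: "mat_adjoint (1\<^sub>m n :: complex mat) = 1\<^sub>m n"
  by (rule eq_matI) auto

lemma mat_adjoint_add:
  assumes "A \<in> carrier_mat p q" and "B \<in> carrier_mat p q"
  shows "mat_adjoint (A + B) = mat_adjoint A + mat_adjoint B"
  using assms by (intro eq_matI) (auto simp: conjugate_dist_add)

lemma mat_adjoint_mult:
  assumes "A \<in> carrier_mat p q" and "B \<in> carrier_mat q r"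
  shows "mat_adjoint (A * B) = mat_adjoint B * mat_adjoint A"
  using assms
  by (intro eq_matI)
    (auto simp: scalar_prod_def sum_conjugate conjugate_dist_mul mult.commute)

lemma cscalar_prod_mult_mat_adjoint:
  assumes A: "A \<in> carrier_mat p q" and v: "v \<in> carrier_vec q" and w: "w \<in> carrier_vec p"
  shows "(A *\<^sub>v v) \<bullet>c w = v \<bullet>c (mat_adjoint A *\<^sub>v w)"
proof -
  have "(A *\<^sub>v v) \<bullet>c w = (\<Sum>i<p. \<Sum>j<q. A $$ (i, j) * v $ j * conjugate (w $ i))"
    using A v w
    by (auto simp: scalar_prod_def sum_distrib_right lessThan_atLeast0 intro!: sum.cong)
  also have "\<dots> = (\<Sum>j<q. \<Sum>i<p. A $$ (i, j) * v $ j * conjugate (w $ i))"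
    by (rule sum.swap)
  also have "\<dots> = v \<bullet>c (mat_adjoint A *\<^sub>v w)"
    using A v w
    by (auto simp: scalar_prod_def sum_distrib_left lessThan_atLeast0 sum_conjugate
        conjugate_dist_mul ac_simps intro!: sum.cong)
  finally show ?thesis .
qed

section \<open>Congruence and definiteness\<close>

lemma hermitian_congruence:
  assumes X: "X \<in> carrier_mat p q" and M: "M \<in> carrier_mat q q" and "hermitian M"
  shows "hermitian (X * M * mat_adjoint X)"
proof -
  have MH: "mat_adjoint M = M"
    using assms by (simp add: hermitian_def)
  have "mat_adjoint (X * M * mat_adjoint X) = X * (mat_adjoint M * mat_adjoint X)"
    using X M by (simp add: mat_adjoint_mult[of _ p q _ p] mat_adjoint_mult[of _ p q _ q])
  then show ?thesis
    using X assoc_mult_mat[OF X M mat_adjoint_carrier[OF X]] by (simp add: hermitian_def MH)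
qed

text \<open>
  Moving the left factor \<open>X\<close> across the inner product turns it into \<open>X\<^sup>H\<close>. Both definiteness
  statements below are read off from this change of variables.
\<close>

lemma quadratic_form_congruence:
  assumes X: "X \<in> carrier_mat p q" and M: "M \<in> carrier_mat q q" and v: "v \<in> carrier_vec p"
  shows "((X * M * mat_adjoint X) *\<^sub>v v) \<bullet>c v
       = (M *\<^sub>v (mat_adjoint X *\<^sub>v v)) \<bullet>c (mat_adjoint X *\<^sub>v v)"
proof -
  have XH: "mat_adjoint X \<in> carrier_mat q p"
    using X by simp
  then have w: "mat_adjoint X *\<^sub>v v \<in> carrier_vec q"
    using v by simp
  have "(X * M * mat_adjoint X) *\<^sub>v v = X *\<^sub>v (M *\<^sub>v (mat_adjoint X *\<^sub>v v))"
    using assoc_mult_mat_vec[OF mult_carrier_mat[OF X M] XH v] assoc_mult_mat_vec[OF X M w]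
    by simp
  then show ?thesis
    using cscalar_prod_mult_mat_adjoint[OF X mult_mat_vec_carrier[OF M w] v] by simp
qed

lemma pos_semidef_congruence:
  assumes X: "X \<in> carrier_mat p q" and M: "M \<in> carrier_mat q q" and psd: "pos_semidef M"
  shows "pos_semidef (X * M * mat_adjoint X)"
  unfolding pos_semidef_def
proof (intro conjI ballI)
  show "hermitian (X * M * mat_adjoint X)"
    using hermitian_congruence[OF X M] psd by (simp add: pos_semidef_def)
next
  fix v :: "complex vec" assume "v \<in> carrier_vec (dim_row (X * M * mat_adjoint X))"
  then have v: "v \<in> carrier_vec p"
    using X by simp
  then have "mat_adjoint X *\<^sub>v v \<in> carrier_vec (dim_row M)"
    using mult_mat_vec_carrier[OF mat_adjoint_carrier[OF X]] M by simp
  then show "0 \<le> ((X * M * mat_adjoint X) *\<^sub>v v) \<bullet>c v"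
    using psd quadratic_form_congruence[OF X M v] by (simp add: pos_semidef_def)
qed

text \<open>
  A right inverse \<open>Y\<close> of \<open>X\<close> makes \<open>X\<^sup>H\<close> injective, since \<open>Y\<^sup>H X\<^sup>H = 1\<close>, so the quadratic form
  of \<open>M\<close> is evaluated at \<open>X\<^sup>H v \<noteq> 0\<close> whenever \<open>v \<noteq> 0\<close>.
\<close>

lemma pos_def_congruence:
  assumes X: "X \<in> carrier_mat p q" and M: "M \<in> carrier_mat q q" and pd: "pos_def M"
    and Y: "Y \<in> carrier_mat q p" and XY: "X * Y = 1\<^sub>m p"
  shows "pos_def (X * M * mat_adjoint X)"
  unfolding pos_def_def
proof (intro conjI ballI impI)
  show "hermitian (X * M * mat_adjoint X)"
    using hermitian_congruence[OF X M] pd by (simp add: pos_def_def)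
next
  fix v :: "complex vec" assume "v \<in> carrier_vec (dim_row (X * M * mat_adjoint X))"
    and "v \<noteq> 0\<^sub>v (dim_row (X * M * mat_adjoint X))"
  then have v: "v \<in> carrier_vec p" and v0: "v \<noteq> 0\<^sub>v p"
    using X by simp_all
  have XH: "mat_adjoint X \<in> carrier_mat q p" and YH: "mat_adjoint Y \<in> carrier_mat p q"
    using X Y by simp_all
  have "mat_adjoint Y * mat_adjoint X = 1\<^sub>m p"
    using mat_adjoint_mult[OF X Y] XY by simp
  then have "mat_adjoint Y *\<^sub>v (mat_adjoint X *\<^sub>v v) = v"
    using assoc_mult_mat_vec[OF YH XH v] v by simp
  moreover have "mat_adjoint Y *\<^sub>v 0\<^sub>v q = 0\<^sub>v p"
    using Y by (intro eq_vecI) auto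
  ultimately have "mat_adjoint X *\<^sub>v v \<noteq> 0\<^sub>v q"
    using v0 by auto
  moreover have "mat_adjoint X *\<^sub>v v \<in> carrier_vec q"
    using XH v by simp
  ultimately show "0 < ((X * M * mat_adjoint X) *\<^sub>v v) \<bullet>c v"
    using pd M quadratic_form_congruence[OF X M v] by (simp add: pos_def_def)
qed

lemma pos_defD:
  assumes "pos_def M" and "v \<in> carrier_vec (dim_row M)" and "v \<noteq> 0\<^sub>v (dim_row M)"
  shows "0 < (M *\<^sub>v v) \<bullet>c v"
  using assms(1)[unfolded pos_def_def, THEN conjunct2, THEN bspec, OF assms(2)] assms(3)
  by (rule mp)

lemma pos_def_imp_pos_semidef:
  assumes "pos_def M"
  shows "pos_semidef M"
  unfolding pos_semidef_def
proof (intro conjI ballI)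
  show "hermitian M"
    using assms by (simp add: pos_def_def)
next
  fix v :: "complex vec" assume v: "v \<in> carrier_vec (dim_row M)"
  show "0 \<le> (M *\<^sub>v v) \<bullet>c v"
  proof (cases "v = 0\<^sub>v (dim_row M)")
    case True
    then have "conjugate v = 0\<^sub>v (dim_row M)"
      by simp
    then have "(M *\<^sub>v v) \<bullet>c v = (M *\<^sub>v v) \<bullet> 0\<^sub>v (dim_row M)"
      by (rule arg_cong)
    also have "\<dots> = 0"
      by (intro scalar_prod_right_zero carrier_vecI) simp
    finally show ?thesis
      by simp
  next
    case False
    then have "0 < (M *\<^sub>v v) \<bullet>c v"
      by (rule pos_defD[OF assms v])
    then show ?thesis
      by (rule less_imp_le)
  qed
qed

text \<open>
  A kernel vector \<open>v \<noteq> 0\<close> would give the quadratic form the value 0, so the determinant is nonzero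
  and \<open>mat_inv\<close>, which is unspecified on singular matrices, is the true inverse.
\<close>

lemma mat_inv_pos_def:
  assumes M: "M \<in> carrier_mat k k" and pd: "pos_def M"
  shows "mat_inv M \<in> carrier_mat k k" and "M * mat_inv M = 1\<^sub>m k" and "mat_inv M * M = 1\<^sub>m k"
proof -
  have "det M \<noteq> 0"
  proof
    assume "det M = 0"
    then obtain v where v: "v \<in> carrier_vec k" "v \<noteq> 0\<^sub>v k" "M *\<^sub>v v = 0\<^sub>v k"
      using det_0_iff_vec_prod_zero[OF M] by blast
    have "0 < (M *\<^sub>v v) \<bullet>c v"
      by (rule pos_defD[OF pd]) (use M v in simp_all)
    then show False
      using v by simp
  qed
  then have "M \<in> Units (ring_mat TYPE(complex) k ())"
    by (rule det_non_zero_imp_unit[OF M])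
  then have "mat_inverse M \<noteq> None"
    using mat_inverse(1)[OF M, of "()"] by blast
  then obtain N where N: "mat_inverse M = Some N"
    by blast
  then show "mat_inv M \<in> carrier_mat k k" "M * mat_inv M = 1\<^sub>m k" "mat_inv M * M = 1\<^sub>m k"
    using mat_inverse(2)[OF M N] N by (simp_all add: mat_inv_def)
qed

text \<open>
  Taking adjoints in \<open>M J = 1\<close> shows that \<open>J\<^sup>H\<close> is a left inverse of \<open>M\<close>; left and right inverses
  agree.
\<close>

lemma mat_adjoint_inverse:
  fixes M :: "complex mat"
  assumes M: "M \<in> carrier_mat k k" and MH: "mat_adjoint M = M"
    and J: "J \<in> carrier_mat k k" and MJ: "M * J = 1\<^sub>m k"
  shows "mat_adjoint J = J"
proof -
  have JH: "mat_adjoint J \<in> carrier_mat k k"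
    using J by simp
  have JHM: "mat_adjoint J * M = 1\<^sub>m k"
    using mat_adjoint_mult[OF M J] MJ MH by simp
  have "mat_adjoint J = mat_adjoint J * (M * J)"
    unfolding MJ right_mult_one_mat[OF JH] ..
  also have "\<dots> = (mat_adjoint J * M) * J"
    using assoc_mult_mat[OF JH M J] by simp
  also have "\<dots> = J"
    unfolding JHM using J by simp
  finally show ?thesis .
qed

section \<open>Blocks of matrices\<close>

lemma card_index_subset:
  assumes "I \<subseteq> {0..<p}"
  shows "card {i. i < p \<and> i \<in> I} = card I"
  using assms by (intro arg_cong[where f = card]) auto

lemma submatrix_carrier:
  assumes "A \<in> carrier_mat p q" and "I \<subseteq> {0..<p}" and "J \<subseteq> {0..<q}"
  shows "submatrix A I J \<in> carrier_mat (card I) (card J)"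
  using assms by (intro carrier_matI) (auto simp: dim_submatrix card_index_subset)

lemma index_submatrix:
  assumes "A \<in> carrier_mat p q" and "I \<subseteq> {0..<p}" and "J \<subseteq> {0..<q}"
    and "i < card I" and "j < card J"
  shows "submatrix A I J $$ (i, j) = A $$ (pick I i, pick J j)"
  using assms by (intro submatrix_index) (auto simp: card_index_subset)

lemma pick_less:
  assumes "I \<subseteq> {0..<p}" and "i < card I"
  shows "pick I i < p"
  using pick_in_set_le[OF assms(2)] assms(1) by auto

lemma pick_eq_iff:
  assumes "i < card I" and "j < card I"
  shows "pick I i = pick I j \<longleftrightarrow> i = j"
  using assms pick_mono_le[of i I j] pick_mono_le[of j I i] by (metis less_irrefl linorder_neqE_nat)

text \<open>
  This turns sums over the positions inside a block into sums over the original indices, where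
  partitions of the index set can be used.
\<close>

lemma sum_pick:
  assumes "finite I"
  shows "(\<Sum>k<card I. f (pick I k)) = sum f I"
proof -
  have inj: "inj_on (pick I) {..<card I}"
    by (auto simp: inj_on_def pick_eq_iff)
  moreover have "pick I ` {..<card I} = I"
    using assms
    by (intro card_subset_eq) (auto simp: pick_in_set_le card_image[OF inj])
  ultimately show ?thesis
    by (metis (no_types, lifting) sum.reindex_cong)
qed

lemma eq_submatrixI:
  assumes "A \<in> carrier_mat p q" and "I \<subseteq> {0..<p}" and "J \<subseteq> {0..<q}"
    and "B \<in> carrier_mat (card I) (card J)"
    and "\<And>i j. i < card I \<Longrightarrow> j < card J \<Longrightarrow> A $$ (pick I i, pick J j) = B $$ (i, j)"
  shows "submatrix A I J = B"
  using assms submatrix_carrier[OF assms(1-3)]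
  by (intro eq_matI) (auto simp: index_submatrix)

lemma submatrix_mat_adjoint:
  assumes "A \<in> carrier_mat p q" and "I \<subseteq> {0..<q}" and "J \<subseteq> {0..<p}"
  shows "submatrix (mat_adjoint A) I J = mat_adjoint (submatrix A J I)"
  using assms submatrix_carrier[of A p q J I]
  by (intro eq_submatrixI[of _ q p]) (auto simp: index_submatrix pick_less)

lemma submatrix_one:
  assumes "I \<subseteq> {0..<p}"
  shows "submatrix (1\<^sub>m p) I I = 1\<^sub>m (card I)"
  using assms
  by (intro eq_submatrixI[of _ p p]) (auto simp: pick_less pick_eq_iff)

lemma submatrix_full:
  assumes "A \<in> carrier_mat p q"
  shows "submatrix A {0..<p} {0..<q} = A"
proof -
  have "pick {0..<r} i = i" if "i < r" for r i
  proof -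
    have "{a \<in> {0..<r}. a < i} = {..<i}"
      using that by auto
    then show ?thesis
      using pick_card_in_set[of i "{0..<r}"] that by simp
  qed
  then show ?thesis
    using assms by (intro eq_submatrixI[of _ p q]) auto
qed

lemma index_submatrix_mult:
  assumes "A \<in> carrier_mat p n" and "B \<in> carrier_mat n q"
    and "I \<subseteq> {0..<p}" and "J \<subseteq> {0..<q}" and "C \<subseteq> {0..<n}"
    and "i < card I" and "j < card J"
  shows "(submatrix A I C * submatrix B C J) $$ (i, j)
       = (\<Sum>k\<in>C. A $$ (pick I i, k) * B $$ (k, pick J j))"
proof -
  have "finite C"
    using assms(5) finite_subset by blast
  have "(submatrix A I C * submatrix B C J) $$ (i, j)
      = (\<Sum>k<card C. A $$ (pick I i, pick C k) * B $$ (pick C k, pick J j))"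
    using assms submatrix_carrier[of A p n I C] submatrix_carrier[of B n q C J]
    by (auto simp: scalar_prod_def index_submatrix lessThan_atLeast0 intro!: sum.cong)
  then show ?thesis
    using sum_pick[OF \<open>finite C\<close>, of "\<lambda>k. A $$ (pick I i, k) * B $$ (k, pick J j)"] by simp
qed

text \<open>
  The sum over the inner index of the product splits along the partition, and each part is the
  product of the corresponding blocks.
\<close>

lemma submatrix_mult_partition:
  fixes A B :: "'a :: comm_ring mat"
  assumes A: "A \<in> carrier_mat p n" and B: "B \<in> carrier_mat n q"
    and I: "I \<subseteq> {0..<p}" and J: "J \<subseteq> {0..<q}"
    and CD: "C \<union> D = {0..<n}" "C \<inter> D = {}"
  shows "submatrix (A * B) I J
       = submatrix A I C * submatrix B C J + submatrix A I D * submatrix B D J"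
proof (rule eq_submatrixI[of _ p q])
  have C: "C \<subseteq> {0..<n}" and D: "D \<subseteq> {0..<n}"
    using CD by auto
  have fin: "finite C" "finite D"
    using C D finite_subset by blast+
  note carr = submatrix_carrier[OF A I C] submatrix_carrier[OF A I D]
    submatrix_carrier[OF B C J] submatrix_carrier[OF B D J]
  show "submatrix A I C * submatrix B C J + submatrix A I D * submatrix B D J
      \<in> carrier_mat (card I) (card J)"
    using carr by auto
  fix i j assume ij: "i < card I" "j < card J"
  let ?f = "\<lambda>k. A $$ (pick I i, k) * B $$ (k, pick J j)"
  have "(A * B) $$ (pick I i, pick J j) = sum ?f (C \<union> D)"
    unfolding CD(1)
    using A B pick_less[OF I ij(1)] pick_less[OF J ij(2)] by (auto simp: scalar_prod_def)
  also have "\<dots> = sum ?f C + sum ?f D"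
    using fin CD(2) by (rule sum.union_disjoint)
  also have "\<dots> = (submatrix A I C * submatrix B C J) $$ (i, j)
      + (submatrix A I D * submatrix B D J) $$ (i, j)"
    using index_submatrix_mult[OF A B I J C ij] index_submatrix_mult[OF A B I J D ij] by simp
  also have "\<dots> = (submatrix A I C * submatrix B C J + submatrix A I D * submatrix B D J) $$ (i, j)"
    using carr ij by simp
  finally show "(A * B) $$ (pick I i, pick J j) = \<dots>" .
qed (use A B I J in auto)

lemma submatrix_mult:
  fixes A B :: "'a :: comm_ring mat"
  assumes A: "A \<in> carrier_mat p n" and B: "B \<in> carrier_mat n q"
    and I: "I \<subseteq> {0..<p}" and J: "J \<subseteq> {0..<q}"
  shows "submatrix (A * B) I J = submatrix A I {0..<n} * submatrix B {0..<n} J"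
proof (rule eq_submatrixI[of _ p q])
  show "submatrix A I {0..<n} * submatrix B {0..<n} J \<in> carrier_mat (card I) (card J)"
    using submatrix_carrier[OF A I, of "{0..<n}"] submatrix_carrier[OF B _ J, of "{0..<n}"] by auto
  fix i j assume ij: "i < card I" "j < card J"
  then show "(A * B) $$ (pick I i, pick J j)
      = (submatrix A I {0..<n} * submatrix B {0..<n} J) $$ (i, j)"
    using index_submatrix_mult[OF A B I J _ ij, of "{0..<n}"]
      A B pick_less[OF I ij(1)] pick_less[OF J ij(2)]
    by (auto simp: scalar_prod_def)
qed (use A B I J in auto)

text \<open>
  A principal block is the congruence of the whole matrix by the 0-1 matrix \<open>F\<close> that
  selects the coordinates in \<open>C\<close>, and \<open>F F\<^sup>H = 1\<close>.
\<close>

lemma pos_def_principal_submatrix: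
  assumes K: "K \<in> carrier_mat n n" and pd: "pos_def K" and C: "C \<subseteq> {0..<n}"
  shows "pos_def (submatrix K C C)"
proof -
  define F :: "complex mat" where "F = submatrix (1\<^sub>m n) C {0..<n}"
  have one: "(1\<^sub>m n :: complex mat) \<in> carrier_mat n n"
    by simp
  have F: "F \<in> carrier_mat (card C) n"
    using submatrix_carrier[OF one C, of "{0..<n}"] by (simp add: F_def)
  have FH: "mat_adjoint F = submatrix (1\<^sub>m n) {0..<n} C"
    using submatrix_mat_adjoint[OF one, of "{0..<n}" C] C by (simp add: F_def)
  have "F * mat_adjoint F = 1\<^sub>m (card C)"
    unfolding FH unfolding F_def
    using submatrix_mult[OF one one C C] by (simp add: submatrix_one[OF C])
  moreover have "submatrix K C C = F * K * mat_adjoint F"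
    unfolding FH unfolding F_def
    using submatrix_mult[OF K one C C] submatrix_mult[OF one K C, of "{0..<n}"]
      K submatrix_full[OF K] by simp
  ultimately show ?thesis
    using pos_def_congruence[OF F K pd, of "mat_adjoint F"] F by simp
qed

section \<open>Completing the square\<close>

text \<open>
  With \<open>U = A\<^sub>C M\<^sub>C\<^sub>C + A\<^sub>D M\<^sub>D\<^sub>C\<close> one has \<open>X M\<^sub>C\<^sub>C = U\<close> and \<open>X\<^sup>H = A\<^sub>C\<^sup>H + J M\<^sub>C\<^sub>D A\<^sub>D\<^sup>H\<close>, the latter because
  \<open>J\<close>, the inverse of a Hermitian matrix, is Hermitian. Expanding \<open>U X\<^sup>H\<close> produces every term of
  the left-hand side except \<open>A\<^sub>D M\<^sub>D\<^sub>D A\<^sub>D\<^sup>H\<close>, which the Schur complement cancels there.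
\<close>

lemma block_Gram_minus_Schur:
  fixes A\<^sub>C A\<^sub>D M\<^sub>C\<^sub>C :: "complex mat"
  assumes a: "A\<^sub>C \<in> carrier_mat q p" and d: "A\<^sub>D \<in> carrier_mat q q"
    and Mcc: "M\<^sub>C\<^sub>C \<in> carrier_mat p p" and Mcd: "M\<^sub>C\<^sub>D \<in> carrier_mat p q"
    and Mdc: "M\<^sub>D\<^sub>C \<in> carrier_mat q p" and Mdd: "M\<^sub>D\<^sub>D \<in> carrier_mat q q"
    and herm: "mat_adjoint M\<^sub>C\<^sub>C = M\<^sub>C\<^sub>C" "mat_adjoint M\<^sub>D\<^sub>C = M\<^sub>C\<^sub>D"
    and J: "J \<in> carrier_mat p p" and MJ: "M\<^sub>C\<^sub>C * J = 1\<^sub>m p" and JM: "J * M\<^sub>C\<^sub>C = 1\<^sub>m p"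
  defines "X \<equiv> A\<^sub>C + A\<^sub>D * M\<^sub>D\<^sub>C * J"
  shows "(A\<^sub>C * M\<^sub>C\<^sub>C + A\<^sub>D * M\<^sub>D\<^sub>C) * mat_adjoint A\<^sub>C + (A\<^sub>C * M\<^sub>C\<^sub>D + A\<^sub>D * M\<^sub>D\<^sub>D) * mat_adjoint A\<^sub>D
       - A\<^sub>D * (M\<^sub>D\<^sub>D - M\<^sub>D\<^sub>C * J * M\<^sub>C\<^sub>D) * mat_adjoint A\<^sub>D
       = X * M\<^sub>C\<^sub>C * mat_adjoint X"
proof -
  let ?aH = "mat_adjoint A\<^sub>C" and ?dH = "mat_adjoint A\<^sub>D"
  define W where "W = A\<^sub>D * M\<^sub>D\<^sub>C"
  define U where "U = A\<^sub>C * M\<^sub>C\<^sub>C + W"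
  \<comment> \<open>\<open>T A\<^sub>D\<^sup>H\<close> is the correction in the Schur complement, and it reappears in \<open>U X\<^sup>H\<close>.\<close>
  define T where "T = W * (J * M\<^sub>C\<^sub>D)"
  have W: "W \<in> carrier_mat q p" and JMcd: "J * M\<^sub>C\<^sub>D \<in> carrier_mat p q"
    using d Mdc J Mcd by (simp_all add: W_def)
  have aH: "?aH \<in> carrier_mat p q" and dH: "?dH \<in> carrier_mat q q"
    using a d by simp_all
  have acc: "A\<^sub>C * M\<^sub>C\<^sub>C \<in> carrier_mat q p" and acd: "A\<^sub>C * M\<^sub>C\<^sub>D \<in> carrier_mat q q"
    and ddd: "A\<^sub>D * M\<^sub>D\<^sub>D \<in> carrier_mat q q"
    using a d Mcc Mcd Mdd by simp_all
  have U: "U \<in> carrier_mat q p"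
    using acc W by (simp add: U_def)
  have T: "T \<in> carrier_mat q q"
    using W JMcd by (simp add: T_def)
  have WJ: "W * J \<in> carrier_mat q p"
    using W J by simp
  have XM: "X * M\<^sub>C\<^sub>C = U"
    using add_mult_distrib_mat[OF a WJ Mcc] assoc_mult_mat[OF W J Mcc] right_mult_one_mat[OF W] JM
    by (simp add: X_def U_def W_def)
  have JH: "mat_adjoint J = J"
    by (rule mat_adjoint_inverse[OF Mcc herm(1) J MJ])
  have "mat_adjoint W = M\<^sub>C\<^sub>D * ?dH"
    using mat_adjoint_mult[OF d Mdc] herm(2) by (simp add: W_def)
  then have XH: "mat_adjoint X = ?aH + J * M\<^sub>C\<^sub>D * ?dH"
    using mat_adjoint_add[OF a WJ] mat_adjoint_mult[OF W J] JH assoc_mult_mat[OF J Mcd dH]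
    by (simp add: X_def W_def)
  have "A\<^sub>C * M\<^sub>C\<^sub>C * (J * M\<^sub>C\<^sub>D) = A\<^sub>C * (M\<^sub>C\<^sub>C * J * M\<^sub>C\<^sub>D)"
    using assoc_mult_mat[OF a Mcc JMcd] assoc_mult_mat[OF Mcc J Mcd] by simp
  then have UJ: "U * (J * M\<^sub>C\<^sub>D) = A\<^sub>C * M\<^sub>C\<^sub>D + T"
    using add_mult_distrib_mat[OF acc W JMcd] MJ Mcd by (simp add: U_def T_def)
  have right: "X * M\<^sub>C\<^sub>C * mat_adjoint X = U * ?aH + (A\<^sub>C * M\<^sub>C\<^sub>D + T) * ?dH"
    using mult_add_distrib_mat[OF U aH mult_carrier_mat[OF JMcd dH]]
      assoc_mult_mat[OF U JMcd dH] UJ by (simp add: XM XH)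
  have WJM: "A\<^sub>D * (M\<^sub>D\<^sub>C * J * M\<^sub>C\<^sub>D) = T"
    using assoc_mult_mat[OF Mdc J Mcd] assoc_mult_mat[OF d Mdc JMcd] by (simp add: T_def W_def)
  have "M\<^sub>D\<^sub>C * J * M\<^sub>C\<^sub>D \<in> carrier_mat q q"
    using Mdc J Mcd by simp
  then have left: "A\<^sub>D * (M\<^sub>D\<^sub>D - M\<^sub>D\<^sub>C * J * M\<^sub>C\<^sub>D) * ?dH = A\<^sub>D * M\<^sub>D\<^sub>D * ?dH - T * ?dH"
    using mult_minus_distrib_mat[OF d Mdd] WJM minus_mult_distrib_mat[OF ddd T dH] by simp
  show ?thesis
    unfolding left right W_def[symmetric] U_def[symmetric]
      add_mult_distrib_mat[OF acd ddd dH] add_mult_distrib_mat[OF acd T dH]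
    using U T acd ddd aH dH by (intro eq_matI) (auto simp del: assoc_mult_mat)
qed

theorem corollary5p1:
  fixes n m :: nat and C D :: "nat set" and S K :: "complex mat" and \<xi> b :: real
  assumes "2 \<le> n"
    and "C \<union> D = {0..<n}" and "C \<inter> D = {}"
    and "card C = m" and "1 \<le> m" and "card D = n - m" and "1 \<le> n - m"
    and "S \<in> carrier_mat n n"
    and "\<xi> \<noteq> 0"
    and "K \<in> carrier_mat n n" and "pos_def K"
    and "0 < b"
  shows
    "submatrix (G_hat n C S K \<xi> b) D D - L_inf C D S K
       = X_mat C D S K * submatrix K C C * mat_adjoint (X_mat C D S K)
     \<and> pos_semidef (X_mat C D S K * submatrix K C C * mat_adjoint (X_mat C D S K))
     \<and> L_inf C D S K \<preceq>\<^sub>L submatrix (G_hat n C S K \<xi> b) D D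
     \<and> (\<forall>S' \<in> carrier_mat n n. submatrix S' D D = submatrix S D D \<longrightarrow>
          limit_rate C D S' K = limit_rate C D S K)"
proof -
  note CD = assms(2,3) and S = assms(8) and K = assms(10) and pd = assms(11)
  have C: "C \<subseteq> {0..<n}" and D: "D \<subseteq> {0..<n}"
    using CD by auto
  define A where "A = A_hat n C S \<xi> b"
  define X where "X = X_mat C D S K"
  define G where "G = submatrix (G_hat n C S K \<xi> b) D D"

  have P: "P_mat n C \<in> carrier_mat n n"
    by (simp add: P_mat_def)
  have A: "A \<in> carrier_mat n n"
    using S P by (simp add: A_def A_hat_def)
  \<comment> \<open>The rows of \<open>P\<close> indexed by D vanish, so \<open>b\<close> and \<open>\<xi>\<close> disappear here.\<close>
  have rows: "submatrix A D J = submatrix S D J" if J: "J \<subseteq> {0..<n}" for J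
  proof (rule eq_submatrixI[OF A D J submatrix_carrier[OF S D J]])
    fix i j assume ij: "i < card D" "j < card J"
    have "pick D i \<notin> C"
      using pick_in_set_le[OF ij(1)] CD(2) by auto
    then show "A $$ (pick D i, pick J j) = submatrix S D J $$ (i, j)"
      using S pick_less[OF D ij(1)] pick_less[OF J ij(2)] index_submatrix[OF S D J ij]
      by (auto simp: A_def A_hat_def P_mat_def mat_diag_def)
  qed

  have KH: "mat_adjoint K = K"
    using pd by (simp add: pos_def_def hermitian_def)
  have pdC: "pos_def (submatrix K C C)"
    by (rule pos_def_principal_submatrix[OF K pd C])
  note a = submatrix_carrier[OF S D C] and d = submatrix_carrier[OF S D D]
    and Kcc = submatrix_carrier[OF K C C] and Kcd = submatrix_carrier[OF K C D]
    and Kdc = submatrix_carrier[OF K D C] and Kdd = submatrix_carrier[OF K D D]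
  note J = mat_inv_pos_def[OF Kcc pdC]
  have X: "X \<in> carrier_mat (card D) (card C)"
    using a d Kdc J(1) by (simp add: X_def X_mat_def)

  have AH: "mat_adjoint A \<in> carrier_mat n n" and AK: "A * K \<in> carrier_mat n n"
    using A K by simp_all
  have "G = submatrix (A * K) D C * submatrix (mat_adjoint A) C D
          + submatrix (A * K) D D * submatrix (mat_adjoint A) D D"
    using submatrix_mult_partition[OF AK AH D D CD] by (simp add: G_def G_hat_def A_def)
  then have G: "G = (submatrix S D C * submatrix K C C + submatrix S D D * submatrix K D C)
            * mat_adjoint (submatrix S D C)
          + (submatrix S D C * submatrix K C D + submatrix S D D * submatrix K D D)
            * mat_adjoint (submatrix S D D)"
    using submatrix_mult_partition[OF A K D C CD] submatrix_mult_partition[OF A K D D CD]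
      submatrix_mat_adjoint[OF A C D] submatrix_mat_adjoint[OF A D D] rows[OF C] rows[OF D]
    by simp
  have herm: "mat_adjoint (submatrix K C C) = submatrix K C C"
    "mat_adjoint (submatrix K D C) = submatrix K C D"
    using submatrix_mat_adjoint[OF K C C] submatrix_mat_adjoint[OF K C D] KH by simp_all
  have eq: "G - L_inf C D S K = X * submatrix K C C * mat_adjoint X"
    unfolding G L_inf_def schur_complement_def X_def X_mat_def
    by (rule block_Gram_minus_Schur[OF a d Kcc Kcd Kdc Kdd herm J])
  have psd: "pos_semidef (X * submatrix K C C * mat_adjoint X)"
    by (rule pos_semidef_congruence[OF X Kcc pos_def_imp_pos_semidef[OF pdC]])
  have "G \<in> carrier_mat (card D) (card D)"
    using AK AH by (auto simp: G_def G_hat_def A_def intro!: submatrix_carrier[OF _ D D])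
  moreover have "L_inf C D S K \<in> carrier_mat (card D) (card D)"
    using d Kdc Kcd by (intro carrier_matI) (simp_all add: L_inf_def)
  ultimately have "L_inf C D S K \<preceq>\<^sub>L G"
    using psd by (simp add: loewner_le_def eq)
  moreover have "limit_rate C D S' K = limit_rate C D S K"
    if "submatrix S' D D = submatrix S D D" for S'
    using that by (simp add: limit_rate_def L_inf_def)
  ultimately show ?thesis
    using eq psd unfolding G_def X_def by blast
qed

end
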